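(* Let $G$ be a finite group. The equality $\mathrm{pot}\,G=|G|$ holds if and only if $G$ is a monolithic group with a non-abelian monolith. Moreover, if $G$ is a monolithic group with a non-abelian monolith, then there exist positive constants $c_1$ and $c_2$ such that $c_1|G|^n<\log|F_n|<c_2|G|^n$ for all $n\ge 1$, where $F_n$ is the $n$-generated free group in the variety $\mathrm{var}\,G$.
   Context: For a finite group $G$, $\mathrm{var}\,G$ denotes the variety of groups generated by $G$, i.e. the class of all groups satisfying every identity (group law) that holds in $G$. For $n\ge1$, $F_n$ denotes the free group of rank $n$ in the variety $\mathrm{var}\,G$ (the relatively free group on $n$ free generators); it is finite, with $|F_n|\le |G|^{|G|^n}$. The potential of $G$ is $\mathrm{pot}\,G=\limsup_{n\to\infty}\sqrt[n]{\log|F_n|}$. A nontrivial group is called monolithic if the intersection of all its nontrivial normal subgroups is nontrivial; this intersection is then called the monolith of the group. *)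

theory Defs
  imports "HOL-Algebra.Algebra" "HOL-Library.Extended_Real"
begin

text \<open>
  A group word in the variables \<open>x\<^sub>0, x\<^sub>1, \<dots>\<close> is a list of letters; the letter
  \<open>(i, True)\<close> stands for \<open>x\<^sub>i\<close> and \<open>(i, False)\<close> for its inverse. Words are not required
  to be reduced.
\<close>

type_synonym gword = "(nat \<times> bool) list"

definition words :: "nat \<Rightarrow> gword set" where
  "words n = lists ({..<n} \<times> UNIV)"

primrec eval_word :: "('a, 'm) monoid_scheme \<Rightarrow> (nat \<Rightarrow> 'a) \<Rightarrow> gword \<Rightarrow> 'a" where
  "eval_word G \<sigma> [] = \<one>\<^bsub>G\<^esub>"
| "eval_word G \<sigma> (x # w) =
     (if snd x then \<sigma> (fst x) else inv\<^bsub>G\<^esub> (\<sigma> (fst x))) \<otimes>\<^bsub>G\<^esub> eval_word G \<sigma> w"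

definition satisfies_identity :: "('a, 'm) monoid_scheme \<Rightarrow> gword \<Rightarrow> gword \<Rightarrow> bool" where
  "satisfies_identity G u v \<longleftrightarrow>
     (\<forall>\<sigma>. range \<sigma> \<subseteq> carrier G \<longrightarrow> eval_word G \<sigma> u = eval_word G \<sigma> v)"

text \<open>
  The groups, of a given type, in the variety generated by \<open>G\<close>.
\<close>

definition variety :: "('a, 'm) monoid_scheme \<Rightarrow> ('b, 'k) monoid_scheme set" where
  "variety G = {H. group H \<and> (\<forall>u v. satisfies_identity G u v \<longrightarrow> satisfies_identity H u v)}"

text \<open>
  The free group of rank \<open>n\<close> in the variety generated by \<open>G\<close>: words in \<open>n\<close> variables modulo
  the identities of \<open>G\<close>. The lemmas below show that it lies in the variety, that it is
  generated by the classes of the variables, and that it has the universal property.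
\<close>

definition identity_rel :: "('a, 'm) monoid_scheme \<Rightarrow> nat \<Rightarrow> (gword \<times> gword) set" where
  "identity_rel G n = {(u, v). u \<in> words n \<and> v \<in> words n \<and> satisfies_identity G u v}"

definition rel_free :: "('a, 'm) monoid_scheme \<Rightarrow> nat \<Rightarrow> gword set monoid" where
  "rel_free G n =
     \<lparr>carrier = words n // identity_rel G n,
      monoid.mult = (\<lambda>A B. \<Union>u\<in>A. \<Union>v\<in>B. identity_rel G n `` {u @ v}),
      monoid.one = identity_rel G n `` {[]}\<rparr>"

definition free_gen :: "('a, 'm) monoid_scheme \<Rightarrow> nat \<Rightarrow> nat \<Rightarrow> gword set" where
  "free_gen G n i = identity_rel G n `` {[(i, True)]}"

text \<open>
  The limit superior is taken in the extended reals, so that its existence needs no boundedness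
  hypothesis. The term for \<open>n = 0\<close> is the junk value \<open>root 0 x = 0\<close> and is irrelevant.
\<close>

definition pot :: "('a, 'm) monoid_scheme \<Rightarrow> ereal" where
  "pot G = limsup (\<lambda>n. ereal (root n (ln (real (order (rel_free G n))))))"

text \<open>
  For the trivial group the intersection is empty-indexed, so \<open>monolith\<close> is only meaningful
  together with \<open>monolithic\<close>, which excludes that group.
\<close>

definition monolith :: "('a, 'm) monoid_scheme \<Rightarrow> 'a set" where
  "monolith G = \<Inter>{N. N \<lhd> G \<and> N \<noteq> {\<one>\<^bsub>G\<^esub>}}"

definition monolithic :: "('a, 'm) monoid_scheme \<Rightarrow> bool" where
  "monolithic G \<longleftrightarrow> group G \<and> carrier G \<noteq> {\<one>\<^bsub>G\<^esub>} \<and> monolith G \<noteq> {\<one>\<^bsub>G\<^esub>}"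

lemma monolith_subgroup:
  assumes "group G" "carrier G \<noteq> {\<one>\<^bsub>G\<^esub>}"
  shows "subgroup (monolith G) G"
proof -
  interpret group G by fact
  have "carrier G \<lhd> G"
    by (simp add: normal_inv_iff subgroup_self)
  then have "carrier G \<in> {N. N \<lhd> G \<and> N \<noteq> {\<one>\<^bsub>G\<^esub>}}"
    using assms(2) by simp
  then show ?thesis
    unfolding monolith_def
    by (intro subgroups_Inter) (auto intro: normal_imp_subgroup)
qed

context group
begin

lemma eval_word_closed [simp]:
  "range \<sigma> \<subseteq> carrier G \<Longrightarrow> eval_word G \<sigma> w \<in> carrier G"
  by (induction w) auto

lemma eval_word_append:
  "range \<sigma> \<subseteq> carrier G \<Longrightarrow> eval_word G \<sigma> (u @ v) = eval_word G \<sigma> u \<otimes> eval_word G \<sigma> v"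
  by (induction u) (auto simp: m_assoc range_subsetD)

end

lemma append_in_words [simp]: "u @ v \<in> words n \<longleftrightarrow> u \<in> words n \<and> v \<in> words n"
  by (simp add: words_def)

lemma Nil_in_words [simp]: "[] \<in> words n"
  by (simp add: words_def)

lemma letter_in_words [simp]: "[(i, b)] \<in> words n \<longleftrightarrow> i < n"
  by (simp add: words_def)

definition inv_word :: "gword \<Rightarrow> gword" where
  "inv_word w = rev (map (\<lambda>(i, b). (i, \<not> b)) w)"

lemma inv_word_in_words [simp]: "w \<in> words n \<Longrightarrow> inv_word w \<in> words n"
  by (auto simp: words_def inv_word_def lists_eq_set)

lemma (in group) eval_inv_word:
  assumes "range \<sigma> \<subseteq> carrier G"
  shows "eval_word G \<sigma> (inv_word w) = inv (eval_word G \<sigma> w)"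
  using assms
proof (induction w)
  case Nil
  then show ?case by (simp add: inv_word_def)
next
  case (Cons x w)
  have x: "\<sigma> (fst x) \<in> carrier G" using Cons.prems by auto
  have "inv_word (x # w) = inv_word w @ [(fst x, \<not> snd x)]"
    by (simp add: inv_word_def case_prod_beta)
  then show ?case
    using Cons x by (simp add: eval_word_append inv_mult_group)
qed

lemma equiv_identity_rel: "equiv (words n) (identity_rel G n)"
  by (rule equivI) (auto simp: identity_rel_def satisfies_identity_def refl_on_def sym_def trans_def)

lemma (in group) satisfies_identity_append:
  "satisfies_identity G u u' \<Longrightarrow> satisfies_identity G v v' \<Longrightarrow>
   satisfies_identity G (u @ v) (u' @ v')"
  by (simp add: satisfies_identity_def eval_word_append)

lemma (in group) rel_free_mult:
  assumes "u \<in> words n" "v \<in> words n"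
  shows "identity_rel G n `` {u} \<otimes>\<^bsub>rel_free G n\<^esub> identity_rel G n `` {v} = identity_rel G n `` {u @ v}"
proof -
  have "congruent2 (identity_rel G n) (identity_rel G n) (\<lambda>u v. identity_rel G n `` {u @ v})"
    by (rule congruent2I[OF equiv_identity_rel equiv_identity_rel];
        rule equiv_class_eq[OF equiv_identity_rel])
       (auto simp: identity_rel_def intro!: satisfies_identity_append, 
        auto simp: satisfies_identity_def)
  from UN_equiv_class2[OF equiv_identity_rel equiv_identity_rel this assms]
  show ?thesis by (simp add: rel_free_def)
qed

lemma rel_free_carrier: "carrier (rel_free G n) = words n // identity_rel G n"
  by (simp add: rel_free_def)

lemma rel_free_one: "\<one>\<^bsub>rel_free G n\<^esub> = identity_rel G n `` {[]}"
  by (simp add: rel_free_def)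

lemma rel_free_cases:
  assumes "A \<in> carrier (rel_free G n)"
  obtains u where "u \<in> words n" "A = identity_rel G n `` {u}"
  using assms by (auto simp: rel_free_carrier elim: quotientE)

lemma class_in_rel_free [simp]:
  "u \<in> words n \<Longrightarrow> identity_rel G n `` {u} \<in> carrier (rel_free G n)"
  by (simp add: rel_free_carrier quotientI)

lemma class_eq_iff:
  "u \<in> words n \<Longrightarrow> v \<in> words n \<Longrightarrow>
   identity_rel G n `` {u} = identity_rel G n `` {v} \<longleftrightarrow> satisfies_identity G u v"
  by (subst eq_equiv_class_iff[OF equiv_identity_rel]) (auto simp: identity_rel_def)

lemma (in group) rel_free_l_inv:
  assumes "u \<in> words n"
  shows "identity_rel G n `` {inv_word u} \<otimes>\<^bsub>rel_free G n\<^esub> identity_rel G n `` {u} = \<one>\<^bsub>rel_free G n\<^esub>"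
  using assms
  by (simp add: rel_free_mult rel_free_one class_eq_iff satisfies_identity_def
      eval_word_append eval_inv_word)

lemma (in group) rel_free_group: "group (rel_free G n)"
proof (rule groupI)
  show "\<one>\<^bsub>rel_free G n\<^esub> \<in> carrier (rel_free G n)"
    by (simp add: rel_free_one)
next
  fix A B assume "A \<in> carrier (rel_free G n)" "B \<in> carrier (rel_free G n)"
  then show "A \<otimes>\<^bsub>rel_free G n\<^esub> B \<in> carrier (rel_free G n)"
    by (auto elim!: rel_free_cases simp: rel_free_mult)
next
  fix A B C
  assume "A \<in> carrier (rel_free G n)" "B \<in> carrier (rel_free G n)" "C \<in> carrier (rel_free G n)"
  then show "A \<otimes>\<^bsub>rel_free G n\<^esub> B \<otimes>\<^bsub>rel_free G n\<^esub> C = A \<otimes>\<^bsub>rel_free G n\<^esub> (B \<otimes>\<^bsub>rel_free G n\<^esub> C)"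
    by (auto elim!: rel_free_cases simp: rel_free_mult)
next
  fix A assume "A \<in> carrier (rel_free G n)"
  then show "\<one>\<^bsub>rel_free G n\<^esub> \<otimes>\<^bsub>rel_free G n\<^esub> A = A"
    by (auto elim!: rel_free_cases simp: rel_free_mult rel_free_one)
next
  fix A assume "A \<in> carrier (rel_free G n)"
  then show "\<exists>B\<in>carrier (rel_free G n). B \<otimes>\<^bsub>rel_free G n\<^esub> A = \<one>\<^bsub>rel_free G n\<^esub>"
    by (metis rel_free_cases rel_free_l_inv inv_word_in_words class_in_rel_free)
qed

lemma (in group) rel_free_inv:
  assumes "u \<in> words n"
  shows "inv\<^bsub>rel_free G n\<^esub> (identity_rel G n `` {u}) = identity_rel G n `` {inv_word u}"
  by (rule group.inv_equality[OF rel_free_group])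
     (use assms in \<open>simp_all add: rel_free_l_inv\<close>)

primrec subst_word :: "(nat \<Rightarrow> gword) \<Rightarrow> gword \<Rightarrow> gword" where
  "subst_word s [] = []"
| "subst_word s (x # w) = (if snd x then s (fst x) else inv_word (s (fst x))) @ subst_word s w"

lemma (in group) eval_subst_word:
  assumes "range \<sigma> \<subseteq> carrier G"
  shows "eval_word G \<sigma> (subst_word s w) = eval_word G (\<lambda>i. eval_word G \<sigma> (s i)) w"
  by (induction w) (use assms in \<open>auto simp: eval_word_append eval_inv_word\<close>)

lemma subst_word_in_words:
  "(\<And>i. s i \<in> words n) \<Longrightarrow> subst_word s w \<in> words n"
  by (induction w) auto

lemma (in group) eval_word_rel_free:
  assumes s: "\<And>i. s i \<in> words n"
  shows "eval_word (rel_free G n) (\<lambda>i. identity_rel G n `` {s i}) w =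
         identity_rel G n `` {subst_word s w}"
  by (induction w)
     (use s in \<open>auto simp: rel_free_mult rel_free_one rel_free_inv subst_word_in_words\<close>)

lemma (in group) rel_free_in_variety: "rel_free G n \<in> variety G"
proof -
  have "satisfies_identity (rel_free G n) u v" if uv: "satisfies_identity G u v" for u v
    unfolding satisfies_identity_def
  proof (intro allI impI)
    fix \<sigma> :: "nat \<Rightarrow> gword set"
    assume "range \<sigma> \<subseteq> carrier (rel_free G n)"
    then have "\<forall>i. \<exists>w. w \<in> words n \<and> \<sigma> i = identity_rel G n `` {w}"
      by (metis range_subsetD rel_free_cases)
    then obtain s where s: "\<And>i. s i \<in> words n" "\<And>i. \<sigma> i = identity_rel G n `` {s i}"
      by metis
    have "satisfies_identity G (subst_word s u) (subst_word s v)"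
      using uv by (auto simp: satisfies_identity_def eval_subst_word image_subset_iff)
    moreover have "\<sigma> = (\<lambda>i. identity_rel G n `` {s i})"
      using s(2) by auto
    ultimately show "eval_word (rel_free G n) \<sigma> u = eval_word (rel_free G n) \<sigma> v"
      using s(1) by (simp add: eval_word_rel_free class_eq_iff subst_word_in_words)
  qed
  then show ?thesis
    by (simp add: variety_def rel_free_group)
qed

lemma (in group) rel_free_generated:
  "generate (rel_free G n) (free_gen G n ` {..<n}) = carrier (rel_free G n)" (is "?L = ?R")
proof
  show "?L \<subseteq> ?R"
    by (rule group.generate_incl[OF rel_free_group]) (auto simp: free_gen_def)
next
  have "identity_rel G n `` {u} \<in> ?L" if "u \<in> words n" for u
    using that
  proof (induction u)
    case Nil
    then show ?case by (metis rel_free_one generate.one)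
  next
    case (Cons x u)
    obtain i b where x: "x = (i, b)" by (cases x)
    have i: "i < n" and u: "u \<in> words n" using Cons.prems x by (auto simp: words_def)
    have g: "free_gen G n i \<in> free_gen G n ` {..<n}" using i by auto
    have "identity_rel G n `` {[x]} \<in> ?L"
    proof (cases b)
      case True
      then show ?thesis using generate.incl[OF g] by (simp add: x free_gen_def)
    next
      case False
      then show ?thesis
        using generate.inv[OF g, of "rel_free G n"] rel_free_inv[of "[(i, True)]" n] i
        by (simp add: x free_gen_def inv_word_def)
    qed
    then show ?case
      using generate.eng[OF _ Cons.IH[OF u], of "identity_rel G n `` {[x]}"]
        rel_free_mult[of "[x]" n u] i u by (simp add: x)
  qed
  then show "?R \<subseteq> ?L"
    by (metis rel_free_cases subsetI)
qed

text \<open>The universal property, for groups of an arbitrary type in the variety.\<close>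

lemma (in group) eval_word_cong:
  assumes "w \<in> words n" "\<And>i. i < n \<Longrightarrow> \<sigma> i = \<tau> i"
  shows "eval_word H \<sigma> w = eval_word H \<tau> w"
  using assms by (induction w) (auto simp: words_def)

lemma (in group) rel_free_universal:
  fixes H :: "('b, 'k) monoid_scheme"
  assumes H: "H \<in> variety G" and y: "\<And>i. i < n \<Longrightarrow> y i \<in> carrier H"
  shows "\<exists>h \<in> hom (rel_free G n) H. (\<forall>i<n. h (free_gen G n i) = y i) \<and>
           (\<forall>h' \<in> hom (rel_free G n) H. (\<forall>i<n. h' (free_gen G n i) = y i) \<longrightarrow>
              (\<forall>A \<in> carrier (rel_free G n). h' A = h A))"
proof -
  interpret H: group H using H by (simp add: variety_def)
  define \<sigma> where "\<sigma> i = (if i < n then y i else \<one>\<^bsub>H\<^esub>)" for i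
  have \<sigma>: "range \<sigma> \<subseteq> carrier H" using y by (auto simp: \<sigma>_def)
  define h where "h A = eval_word H \<sigma> (SOME u. u \<in> A)" for A
  have h: "h (identity_rel G n `` {u}) = eval_word H \<sigma> u" if u: "u \<in> words n" for u
  proof -
    have "u \<in> identity_rel G n `` {u}"
      using u by (simp add: identity_rel_def satisfies_identity_def)
    then have "(SOME v. v \<in> identity_rel G n `` {u}) \<in> identity_rel G n `` {u}"
      by (rule someI)
    then have "(u, SOME v. v \<in> identity_rel G n `` {u}) \<in> identity_rel G n"
      by blast
    then have "satisfies_identity G u (SOME v. v \<in> identity_rel G n `` {u})"
      unfolding identity_rel_def by blast
    then have "satisfies_identity H u (SOME v. v \<in> identity_rel G n `` {u})"
      using H by (simp add: variety_def)
    then show ?thesis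
      using \<sigma> by (simp add: h_def satisfies_identity_def)
  qed
  have hom: "h \<in> hom (rel_free G n) H"
  proof (rule homI)
    fix A assume "A \<in> carrier (rel_free G n)"
    then show "h A \<in> carrier H" by (auto elim!: rel_free_cases simp: h \<sigma>)
  next
    fix A B assume "A \<in> carrier (rel_free G n)" "B \<in> carrier (rel_free G n)"
    then show "h (A \<otimes>\<^bsub>rel_free G n\<^esub> B) = h A \<otimes>\<^bsub>H\<^esub> h B"
      by (auto elim!: rel_free_cases simp: h \<sigma> rel_free_mult H.eval_word_append)
  qed
  have gen: "h (free_gen G n i) = y i" if "i < n" for i
    using that y by (simp add: free_gen_def h \<sigma>_def)
  have "h' A = h A"
    if h': "h' \<in> hom (rel_free G n) H" "\<forall>i<n. h' (free_gen G n i) = y i"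
      and A: "A \<in> carrier (rel_free G n)" for h' A
  proof -
    interpret F: group "rel_free G n" by (rule rel_free_group)
    interpret h: group_hom "rel_free G n" H h by unfold_locales (rule hom)
    interpret h': group_hom "rel_free G n" H h' by unfold_locales (rule h'(1))
    have inc: "free_gen G n ` {..<n} \<subseteq> carrier (rel_free G n)"
      by (auto simp: free_gen_def)
    have "A \<in> generate (rel_free G n) (free_gen G n ` {..<n})"
      using A by (simp add: rel_free_generated)
    then show ?thesis
    proof (induction rule: generate.induct)
      case one
      then show ?case by simp
    next
      case (incl x)
      then show ?case using gen h'(2) by auto
    next
      case (inv x)
      then have "x \<in> carrier (rel_free G n)" using inc by blast
      then show ?case using gen h'(2) inv by auto
    next
      case (eng a b)
      then have "a \<in> carrier (rel_free G n)" "b \<in> carrier (rel_free G n)"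
        by (simp_all add: rel_free_generated)
      then show ?case using eng by simp
    qed
  qed
  then show ?thesis using hom gen by blast
qed

text \<open>Finiteness, so that \<open>order (rel_free G n)\<close> is the actual number of elements.\<close>

lemma (in group) rel_free_finite_card:
  assumes "finite (carrier G)"
  shows "finite (carrier (rel_free G n)) \<and> order (rel_free G n) \<le> order G ^ (order G ^ n)"
proof -
  let ?T = "{..<n} \<rightarrow>\<^sub>E carrier G"
  let ?e = "\<lambda>\<tau> i. if i < n then \<tau> i else \<one>"
  define f where "f w = (\<lambda>\<tau>\<in>?T. eval_word G (?e \<tau>) w)" for w
  have rng: "range (?e \<tau>) \<subseteq> carrier G" if "\<tau> \<in> ?T" for \<tau> :: "nat \<Rightarrow> 'a"
    using that by auto
  have ident: "satisfies_identity G u v"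
    if uv: "u \<in> words n" "v \<in> words n" and eq: "f u = f v" for u v
    unfolding satisfies_identity_def
  proof (intro allI impI)
    fix \<sigma> :: "nat \<Rightarrow> 'a" assume "range \<sigma> \<subseteq> carrier G"
    then have T: "restrict \<sigma> {..<n} \<in> ?T" by auto
    have *: "eval_word G \<sigma> w = f w (restrict \<sigma> {..<n})" if "w \<in> words n" for w
      unfolding f_def restrict_apply'[OF T] by (rule eval_word_cong[OF that]) simp
    show "eval_word G \<sigma> u = eval_word G \<sigma> v"
      using uv eq by (simp add: *)
  qed
  have "\<forall>A. \<exists>u. A \<in> carrier (rel_free G n) \<longrightarrow> u \<in> words n \<and> A = identity_rel G n `` {u}"
    by (blast elim: rel_free_cases)
  then obtain r where r: "\<And>A. A \<in> carrier (rel_free G n) \<Longrightarrow> r A \<in> words n"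
      "\<And>A. A \<in> carrier (rel_free G n) \<Longrightarrow> A = identity_rel G n `` {r A}"
    by metis
  define g where "g A = f (r A)" for A
  have inj: "inj_on g (carrier (rel_free G n))"
  proof (rule inj_onI)
    fix A B
    assume A: "A \<in> carrier (rel_free G n)" and B: "B \<in> carrier (rel_free G n)" and "g A = g B"
    then have "satisfies_identity G (r A) (r B)"
      by (intro ident r) (simp_all add: g_def)
    then have "identity_rel G n `` {r A} = identity_rel G n `` {r B}"
      using r(1)[OF A] r(1)[OF B] by (simp add: class_eq_iff)
    then show "A = B"
      by (rule trans[OF trans[OF r(2)[OF A]] r(2)[OF B, symmetric]])
  qed
  have sub: "g ` carrier (rel_free G n) \<subseteq> ?T \<rightarrow>\<^sub>E carrier G"
  proof (rule image_subsetI)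
    fix A
    show "g A \<in> ?T \<rightarrow>\<^sub>E carrier G"
      unfolding g_def f_def
      by (rule restrict_PiE_iff[THEN iffD2], rule ballI, rule eval_word_closed[OF rng])
  qed
  have finT: "finite ?T" using assms by (simp add: finite_PiE)
  have fin: "finite (?T \<rightarrow>\<^sub>E carrier G)" using assms finT by (simp add: finite_PiE)
  have "card (?T \<rightarrow>\<^sub>E carrier G) = order G ^ (order G ^ n)"
    using finT by (simp add: card_PiE order_def)
  then show ?thesis
    using card_inj_on_le[OF inj sub fin] inj_on_finite[OF inj sub fin] by (simp add: order_def)
qed

end

theory Submission
  imports Defs
begin

text \<open>
  An element of \<open>F\<^sub>n\<close> is a word function \<open>G\<^sup>n \<rightarrow> G\<close>, so \<open>log |F\<^sub>n|\<close> is at most \<open>|G|\<^sup>n log |G|\<close>, and the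
  question is whether the values of word functions at different tuples are essentially
  independent or are tied together.

  Suppose the monolith \<open>M\<close> is non-abelian. Take the tuples that start with a fixed enumeration of
  \<open>G\<close> and are arbitrary afterwards; there are \<open>|G|\<^sup>n\<^sup>-\<^sup>d\<close> of them, with \<open>d = |G|\<close>. For two such tuples
  \<open>a \<noteq> b\<close> some word is trivial at \<open>b\<close> but not at \<open>a\<close>, and the values at \<open>a\<close> of all words trivial at
  \<open>b\<close> form a nontrivial normal subgroup, which contains \<open>M\<close> (\<open>monolith_values\<close>). As the centre of
  \<open>M\<close> is trivial, iterated commutators of such words can be chosen nontrivial at \<open>a\<close>, and they produce
  a word that is nontrivial at \<open>a\<close> and trivial at every other tuple of the family
  (\<open>separating_word\<close>). Products of these words give \<open>2\<close> to the power \<open>|G|\<^sup>n\<^sup>-\<^sup>d\<close> elements of \<open>F\<^sub>n\<close>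
  (\<open>order_rel_free_ge\<close>), which is the lower bound on \<open>log |F\<^sub>n|\<close>.

  In all other cases a nontrivial group has about \<open>(|G|/2)\<^sup>n\<close> tuples that already determine every
  word function. If the nontrivial normal subgroups intersect trivially, a word function is
  determined modulo each of them, hence by its values at tuples of coset representatives
  (\<open>pot_le_half_not_monolithic\<close>). If there is a nontrivial abelian normal subgroup \<open>H\<close>, word
  functions are affine on every coset of \<open>H\<^sup>n\<close> (\<open>eval_word_affine\<close>), hence determined by the tuples
  with at most one coordinate outside a transversal of \<open>H\<close> (\<open>pot_le_half_abelian_normal\<close>). Either
  way the transversals have at most \<open>|G|/2\<close> elements, so the potential is at most \<open>|G|/2\<close>.
\<close>

section \<open>Growth rates and the potential\<close>

text \<open>
  The linear factor leaves room for the choice of one exceptional coordinate in the abelian case;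
  its \<open>n\<close>-th root tends to \<open>1\<close>.
\<close>

lemma pot_le_of_growth:
  assumes C: "C > 0" and q: "q > 0"
    and le: "\<And>n. n \<ge> 1 \<Longrightarrow> ln (real (order (rel_free G n))) \<le> C * real n * q ^ n"
  shows "pot G \<le> ereal q"
proof -
  have "(\<lambda>n. root n C * root n (real n) * q) \<longlonglongrightarrow> 1 * 1 * q"
    by (intro tendsto_intros LIMSEQ_root LIMSEQ_root_const C)
  then have lim: "(\<lambda>n. ereal (root n C * root n (real n) * q)) \<longlonglongrightarrow> ereal q"
    by simp
  have "root n (ln (real (order (rel_free G n)))) \<le> root n C * root n (real n) * q"
    if n: "n \<ge> 1" for n
  proof -
    have "root n (ln (real (order (rel_free G n)))) \<le> root n (C * real n * q ^ n)"
      using le[OF n] n by simp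
    also have "\<dots> = root n C * root n (real n) * q"
      using n q by (simp add: real_root_mult real_root_power_cancel)
    finally show ?thesis .
  qed
  then have "\<forall>\<^sub>F n in sequentially. ereal (root n (ln (real (order (rel_free G n)))))
      \<le> ereal (root n C * root n (real n) * q)"
    by (intro eventually_sequentiallyI[of 1]) simp
  then have "pot G \<le> limsup (\<lambda>n. ereal (root n C * root n (real n) * q))"
    unfolding pot_def by (rule Limsup_mono)
  also have "\<dots> = ereal q"
    by (rule lim_imp_Limsup[OF _ lim]) simp
  finally show ?thesis .
qed

lemma pot_eq_of_growth:
  assumes c: "c1 > 0" "c2 > 0" and q: "q > 0"
    and ge: "\<And>n. n \<ge> 1 \<Longrightarrow> c1 * q ^ n \<le> ln (real (order (rel_free G n)))"
    and le: "\<And>n. n \<ge> 1 \<Longrightarrow> ln (real (order (rel_free G n))) \<le> c2 * q ^ n"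
  shows "pot G = ereal q"
proof -
  let ?x = "\<lambda>n. root n (ln (real (order (rel_free G n))))"
  have lim: "(\<lambda>n. root n c * q) \<longlonglongrightarrow> q" if "c > 0" for c
    using tendsto_mult_right[OF LIMSEQ_root_const[OF that], of q] by simp
  have root: "root n (c * q ^ n) = root n c * q" if "n \<ge> 1" for n c
    using that q by (simp add: real_root_mult real_root_power_cancel)
  have "?x \<longlonglongrightarrow> q"
  proof (rule tendsto_sandwich[OF _ _ lim[OF c(1)] lim[OF c(2)]])
    show "\<forall>\<^sub>F n in sequentially. root n c1 * q \<le> ?x n"
      using ge by (intro eventually_sequentiallyI[of 1]) (simp add: root[symmetric])
    show "\<forall>\<^sub>F n in sequentially. ?x n \<le> root n c2 * q"
      using le by (intro eventually_sequentiallyI[of 1]) (simp add: root[symmetric])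
  qed
  then have "(\<lambda>n. ereal (?x n)) \<longlonglongrightarrow> ereal q"
    by simp
  then show ?thesis
    unfolding pot_def by (rule lim_imp_Limsup[rotated]) simp
qed

section \<open>Bounding the order of a relatively free group by evaluations\<close>

text \<open>
  A word function is recorded by its values at any set of tuples that tells all word functions
  apart; restricting the tuples to \<open>n\<close> coordinates makes that set finite.
\<close>

lemma (in group) order_rel_free_le_determining:
  assumes fin: "finite (carrier G)" and S: "S \<subseteq> {..<n} \<rightarrow>\<^sub>E carrier G"
    and det: "\<And>u v. u \<in> words n \<Longrightarrow> v \<in> words n \<Longrightarrow>
      (\<And>\<sigma>. range \<sigma> \<subseteq> carrier G \<Longrightarrow> restrict \<sigma> {..<n} \<in> S \<Longrightarrow> eval_word G \<sigma> u = eval_word G \<sigma> v) \<Longrightarrow>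
      satisfies_identity G u v"
  shows "order (rel_free G n) \<le> order G ^ card S"
proof -
  let ?e = "\<lambda>\<tau> i. if i < n then \<tau> i else \<one>"
  have finS: "finite S"
    using S fin by (meson finite_PiE finite_lessThan finite_subset)
  have rng: "range (?e \<tau>) \<subseteq> carrier G" if "\<tau> \<in> S" for \<tau> :: "nat \<Rightarrow> 'a"
    using that S by auto
  define f where "f w = (\<lambda>\<tau>\<in>S. eval_word G (?e \<tau>) w)" for w
  have f_cl: "f w \<in> S \<rightarrow>\<^sub>E carrier G" for w
    unfolding f_def using rng by (simp add: restrict_PiE_iff)
  have ident: "satisfies_identity G u v"
    if uv: "u \<in> words n" "v \<in> words n" and eq: "f u = f v" for u v
  proof (rule det[OF uv])
    fix \<sigma> assume \<sigma>: "range \<sigma> \<subseteq> carrier G" "restrict \<sigma> {..<n} \<in> S"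
    have *: "eval_word G \<sigma> w = f w (restrict \<sigma> {..<n})" if "w \<in> words n" for w
      unfolding f_def restrict_apply'[OF \<sigma>(2)] by (rule eval_word_cong[OF that]) simp
    show "eval_word G \<sigma> u = eval_word G \<sigma> v"
      using uv eq by (simp add: *)
  qed
  have "\<forall>A\<in>carrier (rel_free G n). \<exists>u. u \<in> words n \<and> A = identity_rel G n `` {u}"
    by (blast elim: rel_free_cases)
  then obtain r where r: "\<And>A. A \<in> carrier (rel_free G n) \<Longrightarrow>
      r A \<in> words n \<and> A = identity_rel G n `` {r A}"
    by metis
  have "inj_on (\<lambda>A. f (r A)) (carrier (rel_free G n))"
  proof (rule inj_onI)
    fix A B assume AB: "A \<in> carrier (rel_free G n)" "B \<in> carrier (rel_free G n)"
      and "f (r A) = f (r B)"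
    then have "satisfies_identity G (r A) (r B)"
      using r by (intro ident) auto
    then have "identity_rel G n `` {r A} = identity_rel G n `` {r B}"
      using r AB by (intro class_eq_iff[THEN iffD2]) blast+
    then show "A = B"
      by (rule trans[OF trans[OF r[OF AB(1), THEN conjunct2]] r[OF AB(2), THEN conjunct2, symmetric]])
  qed
  moreover have "(\<lambda>A. f (r A)) ` carrier (rel_free G n) \<subseteq> S \<rightarrow>\<^sub>E carrier G"
    using f_cl by blast
  moreover have "finite (S \<rightarrow>\<^sub>E carrier G)"
    using fin finS by (simp add: finite_PiE)
  ultimately have "order (rel_free G n) \<le> card (S \<rightarrow>\<^sub>E carrier G)"
    unfolding order_def by (rule card_inj_on_le)
  then show ?thesis
    using finS by (simp add: card_PiE order_def)
qed

lemma (in group) ln_order_rel_free_le: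
  assumes "finite (carrier G)" and "order (rel_free G n) \<le> order G ^ k" and "real k \<le> b"
  shows "ln (real (order (rel_free G n))) \<le> b * ln (real (order G))"
proof -
  interpret F: group "rel_free G n" by (rule rel_free_group)
  have pos: "order (rel_free G n) > 0" "order G > 0"
    using rel_free_finite_card[OF assms(1), of n] assms(1) F.order_gt_0_iff_finite order_gt_0_iff_finite
    by auto
  have "real (order (rel_free G n)) \<le> real (order G) ^ k"
    using assms(2) by (metis of_nat_le_iff of_nat_power)
  then have "ln (real (order (rel_free G n))) \<le> real k * ln (real (order G))"
    using pos by (metis ln_le_cancel_iff ln_realpow of_nat_0_less_iff zero_less_power)
  also have "\<dots> \<le> b * ln (real (order G))"
    using assms(3) pos by (intro mult_right_mono) auto
  finally show ?thesis .
qed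

text \<open>
  Words that are nontrivial at one valuation and trivial at the others can be multiplied freely:
  the set of valuations at which such a product is nontrivial is arbitrary.
\<close>

lemma (in group) order_rel_free_ge_separating:
  assumes fin: "finite (carrier G)" and I: "finite I"
    and \<sigma>: "\<And>a. a \<in> I \<Longrightarrow> range (\<sigma> a) \<subseteq> carrier G"
    and w: "\<And>a. a \<in> I \<Longrightarrow> w a \<in> words n"
    and sep: "\<And>a b. a \<in> I \<Longrightarrow> b \<in> I \<Longrightarrow> eval_word G (\<sigma> b) (w a) = \<one> \<longleftrightarrow> a \<noteq> b"
  shows "2 ^ card I \<le> order (rel_free G n)"
proof -
  have "\<exists>W\<in>words n. \<forall>a\<in>I. eval_word G (\<sigma> a) W \<noteq> \<one> \<longleftrightarrow> a \<in> J" if "J \<subseteq> I" for J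
    using finite_subset[OF that I] that
  proof (induction J)
    case empty
    then show ?case by (intro bexI[of _ "[]"]) auto
  next
    case (insert b J)
    then obtain W where W: "W \<in> words n" "\<forall>a\<in>I. eval_word G (\<sigma> a) W \<noteq> \<one> \<longleftrightarrow> a \<in> J"
      by auto
    have b: "b \<in> I" using insert.prems by simp
    have "eval_word G (\<sigma> a) (w b @ W) \<noteq> \<one> \<longleftrightarrow> a \<in> insert b J" if a: "a \<in> I" for a
    proof (cases "a = b")
      case True
      then have "eval_word G (\<sigma> a) W = \<one>" using W(2) a insert.hyps by auto
      then show ?thesis using True sep[OF b a] \<sigma>[OF a] by (simp add: eval_word_append)
    next
      case False
      then show ?thesis using W(2) a sep[OF b a] \<sigma>[OF a] by (simp add: eval_word_append)
    qed
    then show ?case using W(1) w[OF b] by (intro bexI[of _ "w b @ W"]) auto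
  qed
  then obtain W where W: "\<And>J. J \<subseteq> I \<Longrightarrow> W J \<in> words n"
    "\<And>J a. J \<subseteq> I \<Longrightarrow> a \<in> I \<Longrightarrow> eval_word G (\<sigma> a) (W J) \<noteq> \<one> \<longleftrightarrow> a \<in> J"
    by metis
  have "inj_on (\<lambda>J. identity_rel G n `` {W J}) (Pow I)"
  proof (rule inj_onI)
    fix J K assume JK: "J \<in> Pow I" "K \<in> Pow I"
      and "identity_rel G n `` {W J} = identity_rel G n `` {W K}"
    then have "satisfies_identity G (W J) (W K)"
      using W(1) by (simp add: class_eq_iff)
    then have "eval_word G (\<sigma> a) (W J) = eval_word G (\<sigma> a) (W K)" if "a \<in> I" for a
      using \<sigma>[OF that] by (simp add: satisfies_identity_def)
    then have "a \<in> J \<longleftrightarrow> a \<in> K" if "a \<in> I" for a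
      using that W(2)[of J a] W(2)[of K a] JK by simp
    then show "J = K" using JK by blast
  qed
  moreover have "(\<lambda>J. identity_rel G n `` {W J}) ` Pow I \<subseteq> carrier (rel_free G n)"
    using W(1) by auto
  ultimately have "card (Pow I) \<le> order (rel_free G n)"
    unfolding order_def using rel_free_finite_card[OF fin, of n] by (intro card_inj_on_le) auto
  then show ?thesis using I by (simp add: card_Pow)
qed

section \<open>A non-abelian monolith makes the free groups large\<close>

lemma (in group) monolith_normal:
  assumes "carrier G \<noteq> {\<one>}"
  shows "monolith G \<lhd> G"
  unfolding normal_inv_iff
proof (intro conjI ballI)
  show "subgroup (monolith G) G"
    using assms is_group by (rule monolith_subgroup[rotated])
  fix x h assume "x \<in> carrier G" "h \<in> monolith G"
  then show "x \<otimes> h \<otimes> inv x \<in> monolith G"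
    by (auto simp: monolith_def normal.inv_op_closed2)
qed

lemma monolith_subset: "N \<lhd> G \<Longrightarrow> N \<noteq> {\<one>\<^bsub>G\<^esub>} \<Longrightarrow> monolith G \<subseteq> N"
  by (auto simp: monolith_def)

lemma (in group) mult_inv_cancel:
  assumes "x \<in> carrier G" "y \<in> carrier G"
  shows "x \<otimes> (inv x \<otimes> y) = y" "inv x \<otimes> (x \<otimes> y) = y"
  using assms by (simp_all flip: m_assoc)

lemma (in group) subgroup_comm_groupI:
  assumes "subgroup M G" and "\<And>x y. x \<in> M \<Longrightarrow> y \<in> M \<Longrightarrow> x \<otimes> y = y \<otimes> x"
  shows "comm_group (G\<lparr>carrier := M\<rparr>)"
  using subgroup.subgroup_is_group[OF assms(1) is_group] assms(2)
  by (intro group.group_comm_groupI) auto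

text \<open>The centre of the monolith is normal in the whole group and smaller than the monolith.\<close>

lemma (in group) monolith_centreless:
  assumes mono: "monolithic G" and nab: "\<not> comm_group (G\<lparr>carrier := monolith G\<rparr>)"
    and m: "m \<in> monolith G" "m \<noteq> \<one>"
  shows "\<exists>k\<in>monolith G. m \<otimes> k \<noteq> k \<otimes> m"
proof (rule ccontr)
  assume no: "\<not> ?thesis"
  let ?M = "monolith G"
  interpret M: normal ?M G
    using mono by (intro monolith_normal) (simp add: monolithic_def)
  define Z where "Z = {z \<in> ?M. \<forall>k\<in>?M. z \<otimes> k = k \<otimes> z}"
  have sub: "subgroup Z G"
  proof (rule subgroupI)
    show "Z \<subseteq> carrier G" by (auto simp: Z_def)
    have "\<one> \<in> Z" by (simp add: Z_def)
    then show "Z \<noteq> {}" by blast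
    show "inv a \<in> Z" if "a \<in> Z" for a
    proof -
      have a: "a \<in> ?M" using that by (simp add: Z_def)
      have "inv a \<otimes> k = k \<otimes> inv a" if k: "k \<in> ?M" for k
      proof -
        have "inv a \<otimes> (k \<otimes> a) \<otimes> inv a = inv a \<otimes> (a \<otimes> k) \<otimes> inv a"
          using \<open>a \<in> Z\<close> k by (simp add: Z_def)
        then show ?thesis using a k by (simp add: m_assoc mult_inv_cancel)
      qed
      then show ?thesis using a by (simp add: Z_def)
    qed
    show "a \<otimes> b \<in> Z" if "a \<in> Z" "b \<in> Z" for a b
    proof -
      have ab: "a \<in> ?M" "b \<in> ?M" using that by (simp_all add: Z_def)
      have "a \<otimes> b \<otimes> k = k \<otimes> (a \<otimes> b)" if k: "k \<in> ?M" for k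
      proof -
        have "a \<otimes> b \<otimes> k = a \<otimes> (k \<otimes> b)"
          using \<open>b \<in> Z\<close> ab k by (simp add: Z_def m_assoc)
        also have "\<dots> = (k \<otimes> a) \<otimes> b"
          using \<open>a \<in> Z\<close> ab k by (simp add: Z_def flip: m_assoc)
        finally show ?thesis using ab k by (simp add: m_assoc)
      qed
      then show ?thesis using ab by (simp add: Z_def)
    qed
  qed
  have conj: "x \<otimes> z \<otimes> inv x \<in> Z" if x: "x \<in> carrier G" and z: "z \<in> Z" for x z
  proof -
    have zM: "z \<in> ?M" using z by (simp add: Z_def)
    have "x \<otimes> z \<otimes> inv x \<otimes> k = k \<otimes> (x \<otimes> z \<otimes> inv x)" if k: "k \<in> ?M" for k
    proof -
      have "inv x \<otimes> k \<otimes> x \<in> ?M" using x k by (rule M.inv_op_closed1)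
      then have "z \<otimes> (inv x \<otimes> k \<otimes> x) = inv x \<otimes> k \<otimes> x \<otimes> z"
        using z by (simp add: Z_def)
      then have "x \<otimes> (z \<otimes> (inv x \<otimes> k \<otimes> x)) \<otimes> inv x = x \<otimes> (inv x \<otimes> k \<otimes> x \<otimes> z) \<otimes> inv x"
        by simp
      then show ?thesis
        using x zM k by (simp add: m_assoc mult_inv_cancel)
    qed
    then show ?thesis using M.inv_op_closed2[OF x zM] by (simp add: Z_def)
  qed
  have "Z \<lhd> G" using sub conj by (simp add: normal_inv_iff)
  moreover have "m \<in> Z" using no m by (auto simp: Z_def)
  ultimately have "?M \<subseteq> Z" using m(2) by (intro monolith_subset) auto
  then have "comm_group (G\<lparr>carrier := ?M\<rparr>)"
    by (intro subgroup_comm_groupI M.subgroup_axioms) (auto simp: Z_def)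
  with nab show False by simp
qed

lemma (in group) eval_word_commutator:
  assumes "range \<sigma> \<subseteq> carrier G"
  shows "eval_word G \<sigma> (u @ v @ inv_word u @ inv_word v)
    = eval_word G \<sigma> u \<otimes> eval_word G \<sigma> v \<otimes> inv (eval_word G \<sigma> u) \<otimes> inv (eval_word G \<sigma> v)"
  using assms by (simp add: eval_word_append eval_inv_word m_assoc)

text \<open>
  The words trivial at \<open>\<tau>\<close> take at \<open>\<sigma>\<close> the values of a normal subgroup, because
  \<open>\<sigma>\<close> generates; one nontrivial value therefore yields the whole monolith.
\<close>

lemma (in group) monolith_values:
  assumes \<sigma>: "range \<sigma> \<subseteq> carrier G" and \<tau>: "range \<tau> \<subseteq> carrier G"
    and gen: "\<And>g. g \<in> carrier G \<Longrightarrow> \<exists>u\<in>words n. eval_word G \<sigma> u = g"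
    and v: "v \<in> words n" "eval_word G \<tau> v = \<one>" "eval_word G \<sigma> v \<noteq> \<one>"
    and m: "m \<in> monolith G"
  shows "\<exists>w\<in>words n. eval_word G \<tau> w = \<one> \<and> eval_word G \<sigma> w = m"
proof -
  define N where "N = eval_word G \<sigma> ` {w \<in> words n. eval_word G \<tau> w = \<one>}"
  have N_I: "eval_word G \<sigma> w \<in> N" if "w \<in> words n" "eval_word G \<tau> w = \<one>" for w
    using that by (auto simp: N_def)
  have "subgroup N G"
  proof (rule subgroupI)
    show "N \<subseteq> carrier G" using \<sigma> by (auto simp: N_def)
    show "N \<noteq> {}" using N_I[OF v(1,2)] by auto
    show "inv a \<in> N" if a: "a \<in> N" for a
    proof -
      obtain w where w: "w \<in> words n" "eval_word G \<tau> w = \<one>" "a = eval_word G \<sigma> w"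
        using a unfolding N_def by blast
      then show ?thesis using N_I[of "inv_word w"] \<sigma> \<tau> by (simp add: eval_inv_word)
    qed
    show "a \<otimes> b \<in> N" if ab: "a \<in> N" "b \<in> N" for a b
    proof -
      obtain w w' where w: "w \<in> words n" "eval_word G \<tau> w = \<one>" "a = eval_word G \<sigma> w"
        "w' \<in> words n" "eval_word G \<tau> w' = \<one>" "b = eval_word G \<sigma> w'"
        using ab unfolding N_def by blast
      then show ?thesis using N_I[of "w @ w'"] \<sigma> \<tau> by (simp add: eval_word_append)
    qed
  qed
  moreover have "x \<otimes> h \<otimes> inv x \<in> N" if x: "x \<in> carrier G" and h: "h \<in> N" for x h
  proof -
    obtain u where u: "u \<in> words n" "eval_word G \<sigma> u = x" using gen[OF x] by auto
    obtain w where w: "w \<in> words n" "eval_word G \<tau> w = \<one>" "h = eval_word G \<sigma> w"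
      using h unfolding N_def by blast
    show ?thesis
      using N_I[of "u @ w @ inv_word u"] u w \<sigma> \<tau>
      by (auto simp: eval_word_append eval_inv_word m_assoc)
  qed
  ultimately have "N \<lhd> G" by (simp add: normal_inv_iff)
  moreover have "N \<noteq> {\<one>}" using N_I[OF v(1,2)] v(3) by auto
  ultimately have "m \<in> N" using monolith_subset m by blast
  then show ?thesis by (auto simp: N_def)
qed

text \<open>
  Words that separate \<open>a\<close> from each other index one at a time combine to a single word by
  taking commutators: a commutator vanishes wherever one of its entries does, and since the
  monolith has trivial centre the second entry can be chosen not to commute with the first at
  \<open>a\<close>.
\<close>

lemma (in group) separating_word:
  assumes mono: "monolithic G" and nab: "\<not> comm_group (G\<lparr>carrier := monolith G\<rparr>)"
    and \<sigma>: "\<And>b. b \<in> insert a B \<Longrightarrow> range (\<sigma> b) \<subseteq> carrier G"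
    and gen: "\<And>g. g \<in> carrier G \<Longrightarrow> \<exists>u\<in>words n. eval_word G (\<sigma> a) u = g"
    and B: "finite B"
    and pair: "\<And>b. b \<in> B \<Longrightarrow> \<exists>v\<in>words n. eval_word G (\<sigma> b) v = \<one> \<and> eval_word G (\<sigma> a) v \<noteq> \<one>"
  shows "\<exists>w\<in>words n. eval_word G (\<sigma> a) w \<in> monolith G - {\<one>} \<and> (\<forall>b\<in>B. eval_word G (\<sigma> b) w = \<one>)"
  using B \<sigma> pair
proof (induction B)
  case empty
  interpret M: normal "monolith G" G
    using mono by (intro monolith_normal) (simp add: monolithic_def)
  obtain m where m: "m \<in> monolith G" "m \<noteq> \<one>"
    using mono M.one_closed unfolding monolithic_def by blast
  then show ?case using gen[of m] by auto
next
  case (insert b B)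
  interpret M: normal "monolith G" G
    using mono by (intro monolith_normal) (simp add: monolithic_def)
  obtain w where w: "w \<in> words n" "eval_word G (\<sigma> a) w \<in> monolith G" "eval_word G (\<sigma> a) w \<noteq> \<one>"
    "\<forall>c\<in>B. eval_word G (\<sigma> c) w = \<one>"
    using insert.IH insert.prems by auto
  obtain k where k: "k \<in> monolith G" "eval_word G (\<sigma> a) w \<otimes> k \<noteq> k \<otimes> eval_word G (\<sigma> a) w"
    using monolith_centreless[OF mono nab w(2,3)] by auto
  have a: "range (\<sigma> a) \<subseteq> carrier G" and b: "range (\<sigma> b) \<subseteq> carrier G"
    using insert.prems(1) by auto
  obtain v where "v \<in> words n" "eval_word G (\<sigma> b) v = \<one>" "eval_word G (\<sigma> a) v \<noteq> \<one>"
    using insert.prems(2) by blast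
  then obtain w' where w': "w' \<in> words n" "eval_word G (\<sigma> b) w' = \<one>" "eval_word G (\<sigma> a) w' = k"
    using monolith_values[OF a b gen _ _ _ k(1)] by blast
  let ?m = "eval_word G (\<sigma> a) w"
  let ?c = "w @ w' @ inv_word w @ inv_word w'"
  have c: "eval_word G (\<sigma> a) ?c = ?m \<otimes> k \<otimes> inv ?m \<otimes> inv k"
    using eval_word_commutator[OF a] w'(3) by simp
  have "?m \<otimes> k \<otimes> inv ?m \<otimes> inv k \<noteq> \<one>"
  proof
    assume "?m \<otimes> k \<otimes> inv ?m \<otimes> inv k = \<one>"
    then have "?m \<otimes> k \<otimes> inv (k \<otimes> ?m) = \<one>"
      using k(1) a by (simp add: inv_mult_group m_assoc)
    then have "?m \<otimes> k = k \<otimes> ?m"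
      using k(1) a by (simp add: inv_solve_right' flip: inv_equality)
    with k(2) show False by simp
  qed
  moreover have "?m \<otimes> k \<otimes> inv ?m \<otimes> inv k \<in> monolith G"
    using w(2) k(1) by simp
  moreover have "eval_word G (\<sigma> d) ?c = \<one>" if d: "d \<in> insert b B" for d
  proof -
    have rd: "range (\<sigma> d) \<subseteq> carrier G" using d insert.prems(1) by auto
    have "eval_word G (\<sigma> d) w = \<one> \<or> eval_word G (\<sigma> d) w' = \<one>"
      using d w(4) w'(2) by auto
    then show ?thesis
      unfolding eval_word_commutator[OF rd] using rd by auto
  qed
  ultimately show ?case
    using w(1) w'(1) c by (intro bexI[of _ ?c]) auto
qed

text \<open>
  Only the tuples that begin with a fixed enumeration of \<open>G\<close> are used. They generate \<open>G\<close>, and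
  where two of them differ, the entry of one is repeated among the first \<open>|G|\<close> coordinates of
  both; so \<open>x\<^sub>i x\<^sub>j\<inverse>\<close> is trivial at one of them only. This takes the place of counting the
  orbits of the automorphism group on all generating tuples.
\<close>

lemma (in group) order_rel_free_ge:
  assumes fin: "finite (carrier G)"
    and mono: "monolithic G" and nab: "\<not> comm_group (G\<lparr>carrier := monolith G\<rparr>)"
    and n: "order G \<le> n"
  shows "2 ^ (order G ^ (n - order G)) \<le> order (rel_free G n)"
proof -
  let ?d = "order G"
  obtain g where g: "bij_betw g {..<?d} (carrier G)"
    using ex_bij_betw_nat_finite[OF fin] by (auto simp: order_def lessThan_atLeast0)
  define I where "I = {?d..<n} \<rightarrow>\<^sub>E carrier G"
  define \<sigma> where "\<sigma> \<tau> i = (if i < ?d then g i else if i < n then \<tau> i else \<one>)" for \<tau> i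
  have rng: "range (\<sigma> \<tau>) \<subseteq> carrier G" if "\<tau> \<in> I" for \<tau>
    using that g by (auto simp: \<sigma>_def I_def bij_betw_def)
  have finI: "finite I" using fin by (simp add: I_def finite_PiE)
  have cardI: "card I = ?d ^ (n - ?d)" by (simp add: I_def card_PiE order_def)
  have enum: "\<exists>j<?d. g j = x" if "x \<in> carrier G" for x
    using that g unfolding bij_betw_def by (metis imageE lessThan_iff)
  have gen: "\<exists>u\<in>words n. eval_word G (\<sigma> \<tau>) u = x" if x: "x \<in> carrier G" for x \<tau>
  proof -
    obtain j where "j < ?d" "g j = x" using enum[OF x] by auto
    then show ?thesis
      using x n by (intro bexI[of _ "[(j, True)]"]) (auto simp: \<sigma>_def)
  qed
  have pair: "\<exists>v\<in>words n. eval_word G (\<sigma> b) v = \<one> \<and> eval_word G (\<sigma> a) v \<noteq> \<one>"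
    if ab: "a \<in> I" "b \<in> I" "a \<noteq> b" for a b
  proof -
    obtain i where i: "i \<in> {?d..<n}" "a i \<noteq> b i"
      using ab unfolding I_def by (metis PiE_ext)
    have cl: "a i \<in> carrier G" "b i \<in> carrier G" using ab i by (auto simp: I_def)
    obtain j where j: "j < ?d" "g j = b i" using enum[OF cl(2)] by auto
    have "a i \<otimes> inv (b i) \<noteq> \<one>"
      using i(2) cl by (metis inv_equality inv_inv inv_closed r_inv)
    then show ?thesis
      using i j cl n by (intro bexI[of _ "[(i, True), (j, False)]"]) (auto simp: \<sigma>_def words_def)
  qed
  have "\<exists>w\<in>words n. eval_word G (\<sigma> a) w \<in> monolith G - {\<one>} \<and> (\<forall>b\<in>I - {a}. eval_word G (\<sigma> b) w = \<one>)"
    if a: "a \<in> I" for a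
    using a rng gen pair finI by (intro separating_word[OF mono nab]) auto
  then obtain w where "\<And>a. a \<in> I \<Longrightarrow> w a \<in> words n"
    "\<And>a. a \<in> I \<Longrightarrow> eval_word G (\<sigma> a) (w a) \<noteq> \<one>"
    "\<And>a b. a \<in> I \<Longrightarrow> b \<in> I \<Longrightarrow> b \<noteq> a \<Longrightarrow> eval_word G (\<sigma> b) (w a) = \<one>"
    by (metis DiffE DiffI singletonD singletonI)
  then have "2 ^ card I \<le> order (rel_free G n)"
    using rng by (intro order_rel_free_ge_separating[OF fin finI, of \<sigma> w]) auto
  then show ?thesis by (simp add: cardI)
qed

lemma (in group) order_rel_free_ge_2:
  assumes fin: "finite (carrier G)" and "carrier G \<noteq> {\<one>}" and n: "n \<ge> 1"
  shows "2 \<le> order (rel_free G n)"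
proof -
  obtain x where x: "x \<in> carrier G" "x \<noteq> \<one>" using assms(2) by auto
  have "2 ^ card {()} \<le> order (rel_free G n)"
    using x n by (intro order_rel_free_ge_separating[OF fin, of _ "\<lambda>_ _. x" "\<lambda>_. [(0, True)]"]) auto
  then show ?thesis by simp
qed

lemma (in group) ln_order_rel_free_bounds:
  assumes fin: "finite (carrier G)"
    and mono: "monolithic G" and nab: "\<not> comm_group (G\<lparr>carrier := monolith G\<rparr>)"
  shows "\<exists>c1 c2 :: real. 0 < c1 \<and> 0 < c2 \<and>
    (\<forall>n\<ge>1. c1 * real (order G) ^ n < ln (real (order (rel_free G n))) \<and>
            ln (real (order (rel_free G n))) < c2 * real (order G) ^ n)"
proof -
  let ?d = "order G"
  have d: "?d \<ge> 1" using fin order_gt_0_iff_finite by (simp add: Suc_leI)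
  \<comment> \<open>The factor \<open>1/2\<close> makes the bound strict; below \<open>n = |G|\<close> it suffices that \<open>F\<^sub>n\<close> is nontrivial.\<close>
  define c1 where "c1 = ln 2 / (2 * real ?d ^ ?d)"
  define c2 where "c2 = ln (real ?d) + 1"
  have c1: "c1 > 0" using d by (simp add: c1_def)
  have c2: "c2 > 0" using d by (simp add: c2_def add_nonneg_pos)
  have "c1 * real ?d ^ n < ln (real (order (rel_free G n)))" if n: "n \<ge> 1" for n
  proof (cases "?d \<le> n")
    case True
    have "real ?d ^ n = real ?d ^ (n - ?d) * real ?d ^ ?d"
      using True by (simp flip: power_add)
    then have "c1 * real ?d ^ n = real ?d ^ (n - ?d) * ln 2 / 2"
      using d by (simp add: c1_def)
    also have "\<dots> < real ?d ^ (n - ?d) * ln 2"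
      using d by simp
    also have "\<dots> = ln (2 ^ (?d ^ (n - ?d)))"
      by (simp add: ln_realpow)
    also have "\<dots> \<le> ln (real (order (rel_free G n)))"
    proof -
      have "real (2 ^ (?d ^ (n - ?d))) \<le> real (order (rel_free G n))"
        using order_rel_free_ge[OF fin mono nab True] by (rule of_nat_mono)
      then show ?thesis by (intro ln_mono) auto
    qed
    finally show ?thesis .
  next
    case False
    then have "real ?d ^ n \<le> real ?d ^ ?d" using d by (intro power_increasing) auto
    then have "c1 * real ?d ^ n \<le> c1 * real ?d ^ ?d" using c1 by simp
    also have "\<dots> = ln 2 / 2" using d by (simp add: c1_def)
    also have "\<dots> < ln 2" by simp
    also have "\<dots> \<le> ln (real (order (rel_free G n)))"
      using order_rel_free_ge_2[OF fin _ n] mono by (simp add: monolithic_def)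
    finally show ?thesis .
  qed
  moreover have "ln (real (order (rel_free G n))) < c2 * real ?d ^ n" for n
  proof -
    have "ln (real (order (rel_free G n))) \<le> real ?d ^ n * ln (real ?d)"
      using ln_order_rel_free_le[OF fin conjunct2[OF rel_free_finite_card[OF fin]], of n "real ?d ^ n"]
      by simp
    also have "\<dots> < c2 * real ?d ^ n" using d by (simp add: c2_def algebra_simps)
    finally show ?thesis .
  qed
  ultimately show ?thesis using c1 c2 by blast
qed

section \<open>Transversals of normal subgroups determine words\<close>

lemma eval_word_hom:
  assumes "h \<in> hom G H" "group G" "group H" "range \<sigma> \<subseteq> carrier G"
  shows "h (eval_word G \<sigma> w) = eval_word H (\<lambda>i. h (\<sigma> i)) w"
proof -
  interpret group_hom G H h
    using assms by (simp add: group_hom_def group_hom_axioms_def)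
  show ?thesis
    by (induction w) (use assms(4) in \<open>auto simp: range_subsetD\<close>)
qed

lemma (in group) rcos_eq_iff:
  assumes "subgroup N G" "a \<in> carrier G" "b \<in> carrier G"
  shows "N #> a = N #> b \<longleftrightarrow> a \<otimes> inv b \<in> N"
  using assms by (metis is_group rcos_self repr_independence subgroup.rcos_module)

lemma (in normal) eval_word_rcos_eq:
  assumes "range \<sigma> \<subseteq> carrier G" "range \<tau> \<subseteq> carrier G" "\<And>i. H #> \<sigma> i = H #> \<tau> i"
  shows "H #> eval_word G \<sigma> w = H #> eval_word G \<tau> w"
  using eval_word_hom[OF r_coset_hom_Mod is_group factorgroup_is_group] assms by simp

lemma (in group) ex_transversal:
  assumes fin: "finite (carrier G)" and N: "subgroup N G" "N \<noteq> {\<one>}"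
  shows "\<exists>r. (\<forall>g\<in>carrier G. r g \<in> carrier G \<and> N #> r g = N #> g) \<and>
    2 * card (r ` carrier G) \<le> order G"
proof -
  define r where "r g = (SOME h. h \<in> N #> g)" for g
  have r: "r g \<in> N #> g" if "g \<in> carrier G" for g
    unfolding r_def using rcos_self[OF that N(1)] by (rule someI)
  have "r ` carrier G \<subseteq> (\<lambda>C. SOME h. h \<in> C) ` (rcosets N)"
    by (auto simp: r_def RCOSETS_def)
  moreover have finR: "finite (rcosets N)"
    using fin by (auto simp: RCOSETS_def)
  ultimately have "card (r ` carrier G) \<le> card (rcosets N)"
    by (meson surj_card_le)
  moreover have "2 \<le> card N"
  proof -
    obtain x where "x \<in> N" "x \<noteq> \<one>" using N subgroup.one_closed[OF N(1)] by blast
    then have "{\<one>, x} \<subseteq> N" "card {\<one>, x} = 2" using subgroup.one_closed[OF N(1)] by auto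
    moreover have "finite N" using fin N(1) finite_subset subgroup.subset by blast
    ultimately show ?thesis by (metis card_mono)
  qed
  ultimately have "card (r ` carrier G) * 2 \<le> order G"
    using lagrange[OF N(1)] by (metis mult_le_mono)
  moreover have "r g \<in> carrier G \<and> N #> r g = N #> g" if "g \<in> carrier G" for g
    using r[OF that] that N(1) r_coset_subset_G[OF subgroup.subset[OF N(1)] that]
    by (metis repr_independence subsetD)
  ultimately show ?thesis by (intro exI[of _ r]) auto
qed

text \<open>
  When the nontrivial normal subgroups intersect trivially, a word function is known once it is
  known modulo each of them, and modulo \<open>N\<close> it depends only on the cosets of its arguments.
\<close>

lemma (in group) pot_le_half_not_monolithic:
  assumes fin: "finite (carrier G)" and mono: "monolith G = {\<one>}"
  shows "pot G \<le> ereal (real (order G) / 2)"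
proof -
  define \<N> where "\<N> = {N. N \<lhd> G \<and> N \<noteq> {\<one>}}"
  have "\<forall>N\<in>\<N>. \<exists>r. (\<forall>g\<in>carrier G. r g \<in> carrier G \<and> N #> r g = N #> g) \<and>
      2 * card (r ` carrier G) \<le> order G"
    using ex_transversal[OF fin] by (auto simp: \<N>_def intro: normal_imp_subgroup)
  then obtain r where r: "\<And>N g. N \<in> \<N> \<Longrightarrow> g \<in> carrier G \<Longrightarrow> r N g \<in> carrier G \<and> N #> r N g = N #> g"
    and card_r: "\<And>N. N \<in> \<N> \<Longrightarrow> 2 * card (r N ` carrier G) \<le> order G"
    by metis
  have fin\<N>: "finite \<N>"
    by (rule finite_subset[of _ "Pow (carrier G)"])
       (use fin in \<open>auto simp: \<N>_def dest: normal_imp_subgroup subgroup.subset\<close>)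
  define S where "S n = (\<Union>N\<in>\<N>. {..<n} \<rightarrow>\<^sub>E r N ` carrier G)" for n :: nat
  have S: "S n \<subseteq> {..<n} \<rightarrow>\<^sub>E carrier G" for n
    unfolding S_def by (intro UN_least PiE_mono) (use r in blast)
  have det: "order (rel_free G n) \<le> order G ^ card (S n)" for n
  proof (rule order_rel_free_le_determining[OF fin S])
    fix u v assume uv: "u \<in> words n" "v \<in> words n"
      and eq: "\<And>\<sigma>. range \<sigma> \<subseteq> carrier G \<Longrightarrow> restrict \<sigma> {..<n} \<in> S n \<Longrightarrow> eval_word G \<sigma> u = eval_word G \<sigma> v"
    show "satisfies_identity G u v"
      unfolding satisfies_identity_def
    proof (intro allI impI)
      fix \<sigma> :: "nat \<Rightarrow> 'a" assume \<sigma>: "range \<sigma> \<subseteq> carrier G"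
      have cl: "eval_word G \<sigma> u \<in> carrier G" "eval_word G \<sigma> v \<in> carrier G" using \<sigma> by auto
      have "eval_word G \<sigma> u \<otimes> inv (eval_word G \<sigma> v) \<in> N" if N: "N \<in> \<N>" for N
      proof -
        interpret N: normal N G using N by (simp add: \<N>_def)
        let ?\<tau> = "\<lambda>i. r N (\<sigma> i)"
        have \<tau>: "range ?\<tau> \<subseteq> carrier G" "\<And>i. N #> \<sigma> i = N #> ?\<tau> i"
          using r[OF N] \<sigma> by auto
        have "restrict ?\<tau> {..<n} \<in> {..<n} \<rightarrow>\<^sub>E r N ` carrier G"
          using \<sigma> by auto
        then have "eval_word G ?\<tau> u = eval_word G ?\<tau> v"
          using \<tau>(1) N by (intro eq) (auto simp: S_def)
        then have "N #> eval_word G \<sigma> u = N #> eval_word G \<sigma> v"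
          using N.eval_word_rcos_eq[OF \<sigma> \<tau>] by simp
        then show ?thesis using rcos_eq_iff[OF N.subgroup_axioms cl] by simp
      qed
      then have "eval_word G \<sigma> u \<otimes> inv (eval_word G \<sigma> v) \<in> monolith G"
        by (auto simp: monolith_def \<N>_def)
      then have "eval_word G \<sigma> u \<otimes> inv (eval_word G \<sigma> v) = \<one>" using mono by simp
      then show "eval_word G \<sigma> u = eval_word G \<sigma> v"
        using cl by (metis inv_equality inv_inv inv_closed)
    qed
  qed
  have pos: "order G > 0" using fin order_gt_0_iff_finite by simp
  have card_S: "real (card (S n)) \<le> real (card \<N>) * (real (order G) / 2) ^ n" for n
  proof -
    have "real (card (S n)) \<le> real (\<Sum>N\<in>\<N>. card ({..<n} \<rightarrow>\<^sub>E r N ` carrier G))"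
      unfolding S_def using card_UN_le[OF fin\<N>] by (rule of_nat_mono)
    also have "\<dots> = (\<Sum>N\<in>\<N>. real (card (r N ` carrier G)) ^ n)"
      by (simp add: card_PiE)
    also have "\<dots> \<le> (\<Sum>N\<in>\<N>. (real (order G) / 2) ^ n)"
      using card_r by (intro sum_mono power_mono) fastforce+
    finally show ?thesis by simp
  qed
  show ?thesis
  proof (rule pot_le_of_growth[where C = "real (card \<N>) * ln (real (order G)) + 1"])
    show "real (order G) / 2 > 0" "real (card \<N>) * ln (real (order G)) + 1 > 0"
      using pos by (simp_all add: add_nonneg_pos)
    fix n :: nat assume n: "n \<ge> 1"
    have "ln (real (order (rel_free G n))) \<le> real (card \<N>) * (real (order G) / 2) ^ n * ln (real (order G))"
      using ln_order_rel_free_le[OF fin det card_S] .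
    also have "\<dots> = (real (card \<N>) * ln (real (order G))) * 1 * (real (order G) / 2) ^ n"
      by simp
    also have "\<dots> \<le> (real (card \<N>) * ln (real (order G)) + 1) * real n * (real (order G) / 2) ^ n"
      using pos n by (intro mult_right_mono mult_mono) auto
    finally show "ln (real (order (rel_free G n)))
      \<le> (real (card \<N>) * ln (real (order G)) + 1) * real n * (real (order G) / 2) ^ n" .
  qed
qed

text \<open>
  On triples that are congruent modulo an abelian normal subgroup, \<open>a b\<inverse> c\<close> is a
  homomorphism, since \<open>b\<inverse> c\<close> and \<open>a' b'\<inverse>\<close> lie in the subgroup and commute. In other words,
  word functions are affine on the cosets of a power of the subgroup.
\<close>

lemma (in normal) eval_word_affine:
  assumes ab: "\<And>x y. x \<in> H \<Longrightarrow> y \<in> H \<Longrightarrow> x \<otimes> y = y \<otimes> x"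
    and rng: "range \<rho> \<subseteq> carrier G" "range \<sigma> \<subseteq> carrier G" "range \<tau> \<subseteq> carrier G"
    and cong: "\<And>i. H #> \<rho> i = H #> \<sigma> i" "\<And>i. H #> \<sigma> i = H #> \<tau> i"
  shows "eval_word G (\<lambda>i. \<rho> i \<otimes> inv (\<sigma> i) \<otimes> \<tau> i) w
    = eval_word G \<rho> w \<otimes> inv (eval_word G \<sigma> w) \<otimes> eval_word G \<tau> w"
proof -
  have left: "a \<otimes> inv b \<in> H" and right: "inv b \<otimes> c \<in> H"
    if "a \<in> carrier G" "b \<in> carrier G" "c \<in> carrier G" "H #> a = H #> b" "H #> b = H #> c" for a b c
  proof -
    show "a \<otimes> inv b \<in> H"
      using that rcos_eq_iff[OF subgroup_axioms] by blast
    have "c \<otimes> inv b \<in> H"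
      using that rcos_eq_iff[OF subgroup_axioms] by metis
    then have "inv b \<otimes> (c \<otimes> inv b) \<otimes> b \<in> H"
      using that by (intro inv_op_closed1) auto
    then show "inv b \<otimes> c \<in> H" using that by (simp add: m_assoc)
  qed
  have mult: "(a \<otimes> inv b \<otimes> c) \<otimes> (a' \<otimes> inv b' \<otimes> c') = (a \<otimes> a') \<otimes> inv (b \<otimes> b') \<otimes> (c \<otimes> c')"
    if cl: "a \<in> carrier G" "b \<in> carrier G" "c \<in> carrier G"
      "a' \<in> carrier G" "b' \<in> carrier G" "c' \<in> carrier G"
      and H: "inv b \<otimes> c \<in> H" "a' \<otimes> inv b' \<in> H" for a b c a' b' c'
  proof -
    have "(a \<otimes> inv b \<otimes> c) \<otimes> (a' \<otimes> inv b' \<otimes> c') = a \<otimes> ((inv b \<otimes> c) \<otimes> (a' \<otimes> inv b')) \<otimes> c'"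
      using cl by (simp add: m_assoc)
    also have "\<dots> = a \<otimes> ((a' \<otimes> inv b') \<otimes> (inv b \<otimes> c)) \<otimes> c'"
      using ab[OF H] by simp
    also have "\<dots> = (a \<otimes> a') \<otimes> inv (b \<otimes> b') \<otimes> (c \<otimes> c')"
      using cl by (simp add: m_assoc inv_mult_group)
    finally show ?thesis .
  qed
  have letter_inv: "inv (a \<otimes> inv b \<otimes> c) = inv a \<otimes> inv (inv b) \<otimes> inv c"
    if cl: "a \<in> carrier G" "b \<in> carrier G" "c \<in> carrier G"
      and H: "a \<otimes> inv b \<in> H" "inv b \<otimes> c \<in> H" for a b c
  proof -
    have "c \<otimes> inv b \<in> H"
      using inv_op_closed2[OF cl(2) H(2)] cl by (simp add: m_assoc[symmetric])
    then have "(a \<otimes> inv b) \<otimes> (c \<otimes> inv b) = (c \<otimes> inv b) \<otimes> (a \<otimes> inv b)"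
      using H(1) by (rule ab[rotated])
    then have "(a \<otimes> inv b) \<otimes> (c \<otimes> inv b) \<otimes> b = (c \<otimes> inv b) \<otimes> (a \<otimes> inv b) \<otimes> b"
      by simp
    then have "a \<otimes> inv b \<otimes> c = c \<otimes> inv b \<otimes> a"
      using cl by (simp add: m_assoc)
    then show ?thesis
      using cl by (simp add: inv_mult_group m_assoc)
  qed
  let ?L = "\<lambda>\<sigma> x. if snd x then \<sigma> (fst x) else inv (\<sigma> (fst x))"
  show ?thesis
  proof (induction w)
    case Nil
    then show ?case by simp
  next
    case (Cons x w)
    have cl: "\<rho> i \<in> carrier G" "\<sigma> i \<in> carrier G" "\<tau> i \<in> carrier G" for i
      using rng by auto
    have letter: "?L (\<lambda>i. \<rho> i \<otimes> inv (\<sigma> i) \<otimes> \<tau> i) x = ?L \<rho> x \<otimes> inv (?L \<sigma> x) \<otimes> ?L \<tau> x"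
      using letter_inv[OF cl left[OF cl cong] right[OF cl cong]] by simp
    have coset: "H #> ?L \<sigma> x = H #> ?L \<tau> x"
      using eval_word_rcos_eq[OF rng(2,3) cong(2), of "[x]"] cl by (cases "snd x") auto
    have "inv (?L \<sigma> x) \<otimes> ?L \<tau> x \<in> H"
      using cl coset by (intro right[of "?L \<sigma> x"]) auto
    moreover have "eval_word G \<rho> w \<otimes> inv (eval_word G \<sigma> w) \<in> H"
      using rng eval_word_rcos_eq[OF rng(1,2) cong(1), of w] rcos_eq_iff[OF subgroup_axioms]
      by simp
    ultimately have "(?L \<rho> x \<otimes> inv (?L \<sigma> x) \<otimes> ?L \<tau> x)
        \<otimes> (eval_word G \<rho> w \<otimes> inv (eval_word G \<sigma> w) \<otimes> eval_word G \<tau> w)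
      = (?L \<rho> x \<otimes> eval_word G \<rho> w) \<otimes> inv (?L \<sigma> x \<otimes> eval_word G \<sigma> w) \<otimes> (?L \<tau> x \<otimes> eval_word G \<tau> w)"
      using cl rng by (intro mult) auto
    then show ?case
      using Cons.IH letter by simp
  qed
qed

text \<open>
  An affine function on a power of \<open>H\<close> is known from its values at the origin and along the
  coordinate axes. Hence a word function is known from the tuples all of whose coordinates,
  except possibly one, are chosen representatives of the cosets of \<open>H\<close>.
\<close>

lemma (in normal) pot_le_half_abelian_normal:
  assumes fin: "finite (carrier G)" and nontriv: "H \<noteq> {\<one>}"
    and ab: "\<And>x y. x \<in> H \<Longrightarrow> y \<in> H \<Longrightarrow> x \<otimes> y = y \<otimes> x"
  shows "pot G \<le> ereal (real (order G) / 2)"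
proof -
  obtain r where r: "\<And>g. g \<in> carrier G \<Longrightarrow> r g \<in> carrier G \<and> H #> r g = H #> g"
    and card_r: "2 * card (r ` carrier G) \<le> order G"
    using ex_transversal[OF fin subgroup_axioms nontriv] by blast
  let ?T = "r ` carrier G"
  define A where "A n k = ({..<n} \<rightarrow>\<^sub>E carrier G) \<inter> {\<tau>. \<forall>i\<in>{..<n} - {k}. \<tau> i \<in> ?T}" for n k :: nat
  define S where "S n = (\<Union>k<n. A n k)" for n
  have S: "S n \<subseteq> {..<n} \<rightarrow>\<^sub>E carrier G" for n
    by (auto simp: S_def A_def)
  have det: "order (rel_free G n) \<le> order G ^ card (S n)" if n: "n \<ge> 1" for n
  proof (rule order_rel_free_le_determining[OF fin S])
    fix u v assume uv: "u \<in> words n" "v \<in> words n"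
      and eq: "\<And>\<sigma>. range \<sigma> \<subseteq> carrier G \<Longrightarrow> restrict \<sigma> {..<n} \<in> S n \<Longrightarrow> eval_word G \<sigma> u = eval_word G \<sigma> v"
    show "satisfies_identity G u v"
      unfolding satisfies_identity_def
    proof (intro allI impI)
      fix \<pi> :: "nat \<Rightarrow> 'a" assume \<pi>: "range \<pi> \<subseteq> carrier G"
      define t where "t i = r (\<pi> i)" for i
      have \<pi>': "\<pi> i \<in> carrier G" for i using \<pi> by auto
      have t: "t i \<in> carrier G" "H #> t i = H #> \<pi> i" for i
        using r \<pi>' by (auto simp: t_def)
      have axis: "eval_word G (t(k := \<pi> k)) u = eval_word G (t(k := \<pi> k)) v" if "k < n" for k
        using that \<pi>' t by (intro eq) (auto simp: S_def A_def t_def)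
      have origin: "eval_word G t u = eval_word G t v"
      proof (rule eq)
        show "range t \<subseteq> carrier G" using t by auto
        have "restrict t {..<n} \<in> A n 0" using \<pi>' t by (auto simp: A_def t_def)
        then show "restrict t {..<n} \<in> S n" using n by (auto simp: S_def)
      qed
      \<comment> \<open>Replace the representatives by the entries of \<open>\<pi>\<close> one coordinate at a time.\<close>
      let ?p = "\<lambda>k i. if i < k then \<pi> i else t i"
      have "eval_word G (?p k) u = eval_word G (?p k) v" if "k \<le> n" for k
        using that
      proof (induction k)
        case 0
        then show ?case using origin by simp
      next
        case (Suc k)
        have "?p (Suc k) = (\<lambda>i. ?p k i \<otimes> inv (t i) \<otimes> (t(k := \<pi> k)) i)"
          using \<pi>' t by (auto simp: fun_eq_iff m_assoc mult_inv_cancel less_Suc_eq)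
        moreover have "eval_word G (\<lambda>i. ?p k i \<otimes> inv (t i) \<otimes> (t(k := \<pi> k)) i) w
            = eval_word G (?p k) w \<otimes> inv (eval_word G t w) \<otimes> eval_word G (t(k := \<pi> k)) w" for w
          using \<pi>' t by (intro eval_word_affine ab) auto
        ultimately show ?case
          using Suc axis[of k] origin by simp
      qed
      from this[of n] have "eval_word G (?p n) u = eval_word G (?p n) v" by simp
      moreover have "eval_word G (?p n) w = eval_word G \<pi> w" if "w \<in> words n" for w
        using that by (rule eval_word_cong) simp
      ultimately show "eval_word G \<pi> u = eval_word G \<pi> v" using uv by simp
    qed
  qed
  have pos: "order G > 0" using fin order_gt_0_iff_finite by simp
  have T: "card ?T \<ge> 1"
  proof -
    have "?T \<noteq> {}" using one_closed by blast
    then show ?thesis using fin by (simp add: Suc_leI card_gt_0_iff)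
  qed
  have card_A: "card (A n k) \<le> order G * card ?T ^ n" if k: "k < n" for n k
  proof -
    have "A n k \<subseteq> (\<Pi>\<^sub>E i\<in>{..<n}. if i = k then carrier G else ?T)"
      by (auto simp: A_def PiE_iff)
    moreover have "finite (\<Pi>\<^sub>E i\<in>{..<n}. if i = k then carrier G else ?T)"
      using fin by (intro finite_PiE) auto
    ultimately have "card (A n k) \<le> card (\<Pi>\<^sub>E i\<in>{..<n}. if i = k then carrier G else ?T)"
      by (rule card_mono[rotated])
    also have "\<dots> = (\<Prod>i<n. if i = k then order G else card ?T)"
      by (simp add: card_PiE order_def if_distrib cong: if_cong)
    also have "\<dots> = order G * card ?T ^ (n - 1)"
      using k by (simp add: prod.remove[of _ k] card_Diff_singleton)
    also have "\<dots> \<le> order G * card ?T ^ n"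
      using T by (intro mult_le_mono2 power_increasing) auto
    finally show ?thesis .
  qed
  have card_S: "real (card (S n)) \<le> real (order G) * real n * (real (order G) / 2) ^ n" for n
  proof -
    have "card (S n) \<le> (\<Sum>k<n. card (A n k))"
      unfolding S_def by (rule card_UN_le) simp
    also have "\<dots> \<le> (\<Sum>k<n. order G * card ?T ^ n)"
      using card_A by (intro sum_mono) auto
    finally have "card (S n) \<le> n * (order G * card ?T ^ n)"
      by simp
    then have "real (card (S n)) \<le> real (n * (order G * card ?T ^ n))"
      by (rule of_nat_mono)
    also have "\<dots> = real (order G) * real n * real (card ?T) ^ n"
      by simp
    also have "\<dots> \<le> real (order G) * real n * (real (order G) / 2) ^ n"
      using card_r by (intro mult_left_mono power_mono) auto
    finally show ?thesis .
  qed
  show ?thesis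
  proof (rule pot_le_of_growth[where C = "real (order G) * ln (real (order G)) + 1"])
    show "real (order G) / 2 > 0" "real (order G) * ln (real (order G)) + 1 > 0"
      using pos by (simp_all add: add_nonneg_pos)
    fix n :: nat assume n: "n \<ge> 1"
    have "ln (real (order (rel_free G n)))
        \<le> real (order G) * real n * (real (order G) / 2) ^ n * ln (real (order G))"
      using ln_order_rel_free_le[OF fin det[OF n] card_S] .
    also have "\<dots> = (real (order G) * ln (real (order G))) * (real n * (real (order G) / 2) ^ n)"
      by simp
    also have "\<dots> \<le> (real (order G) * ln (real (order G)) + 1) * (real n * (real (order G) / 2) ^ n)"
      by (intro mult_right_mono) auto
    finally show "ln (real (order (rel_free G n)))
      \<le> (real (order G) * ln (real (order G)) + 1) * real n * (real (order G) / 2) ^ n"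
      by (simp add: mult.assoc)
  qed
qed

section \<open>Groups of maximal potential\<close>

lemma (in group) pot_trivial:
  assumes "carrier G = {\<one>}"
  shows "pot G \<le> ereal (1 / 2)"
proof (rule pot_le_of_growth[where C = 1])
  fix n :: nat
  have "order G = 1" using assms by (simp add: order_def)
  then have "ln (real (order (rel_free G n))) \<le> 0"
    using ln_order_rel_free_le[OF _ conjunct2[OF rel_free_finite_card], of n 1] assms by simp
  also have "0 \<le> 1 * real n * (1 / 2) ^ n" by simp
  finally show "ln (real (order (rel_free G n))) \<le> 1 * real n * (1 / 2) ^ n" .
qed simp_all

lemma (in group) pot_le_half:
  assumes fin: "finite (carrier G)"
    and no: "\<not> (monolithic G \<and> \<not> comm_group (G\<lparr>carrier := monolith G\<rparr>))"
  shows "pot G \<le> ereal (real (order G) / 2)"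
proof (cases "carrier G = {\<one>}")
  case True
  then show ?thesis using pot_trivial by (simp add: order_def)
next
  case nontriv: False
  show ?thesis
  proof (cases "monolith G = {\<one>}")
    case True
    then show ?thesis using pot_le_half_not_monolithic[OF fin] by simp
  next
    case False
    interpret M: normal "monolith G" G by (rule monolith_normal[OF nontriv])
    have "comm_group (G\<lparr>carrier := monolith G\<rparr>)"
      using no False nontriv is_group by (auto simp: monolithic_def)
    then have "x \<otimes> y = y \<otimes> x" if "x \<in> monolith G" "y \<in> monolith G" for x y
      using that comm_monoid.m_comm[of "G\<lparr>carrier := monolith G\<rparr>" x y]
      by (simp add: comm_group_def)
    then show ?thesis by (intro M.pot_le_half_abelian_normal[OF fin False])
  qed
qed

theorem theorem1:
  fixes G :: "('a, 'm) monoid_scheme"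
  assumes "group G" and "finite (carrier G)"
  shows "(pot G = ereal (real (order G)) \<longleftrightarrow>
            monolithic G \<and> \<not> comm_group (G\<lparr>carrier := monolith G\<rparr>)) \<and>
         (monolithic G \<and> \<not> comm_group (G\<lparr>carrier := monolith G\<rparr>) \<longrightarrow>
            (\<exists>c1 c2 :: real. 0 < c1 \<and> 0 < c2 \<and>
               (\<forall>n\<ge>1. c1 * real (order G) ^ n < ln (real (order (rel_free G n))) \<and>
                       ln (real (order (rel_free G n))) < c2 * real (order G) ^ n)))"
proof -
  interpret group G by fact
  have pos: "order G > 0" using assms(2) order_gt_0_iff_finite by simp
  show ?thesis
  proof (cases "monolithic G \<and> \<not> comm_group (G\<lparr>carrier := monolith G\<rparr>)")
    case True
    then obtain c1 c2 :: real where c: "0 < c1" "0 < c2"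
      "\<forall>n\<ge>1. c1 * real (order G) ^ n < ln (real (order (rel_free G n))) \<and>
         ln (real (order (rel_free G n))) < c2 * real (order G) ^ n"
      using ln_order_rel_free_bounds[OF assms(2)] by blast
    then have "pot G = ereal (real (order G))"
      using pos by (intro pot_eq_of_growth[of c1 c2]) (auto simp: less_imp_le)
    then show ?thesis using True c by blast
  next
    case False
    then have "pot G \<le> ereal (real (order G) / 2)" by (rule pot_le_half[OF assms(2)])
    also have "\<dots> < ereal (real (order G))" using pos by simp
    finally have "pot G \<noteq> ereal (real (order G))" by (rule less_imp_neq)
    then show ?thesis using False by blast
  qed
qed

end
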